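(* Let $\alpha_R,\alpha_F\in[0,1)$, let $T_{\rm D}:\mathbb{R}\rightrightarrows\mathbb{R}$ be monotone and outer semicontinuous, and let $T_{\rm NPN}:\mathbb{R}^2\rightrightarrows\mathbb{R}^2$ be the Ebers--Moll transistor operator $$T_{\rm NPN}\begin{pmatrix} v_1 \\ v_2 \end{pmatrix}=\left\{\begin{pmatrix} 1 & -\alpha_R \\ -\alpha_F & 1 \end{pmatrix}\begin{pmatrix} u_1 \\ u_2 \end{pmatrix}: u_1\in T_{\rm D}(v_1),\ u_2\in T_{\rm D}(v_2)\right\}.$$ Then $T_{\rm NPN}$ is $\theta$-angle-bounded, where $$\theta=\frac{\pi}{2}+\max(\arctan(\alpha_F),\arctan(\alpha_R)).$$
   Context: For a set-valued operator $A:\mathbb{R}^n\rightrightarrows\mathbb{R}^n$, its graph is $\operatorname{gph}A=\{(x,u): u\in A(x)\}$. $A$ is outer semicontinuous if $\operatorname{gph}A$ is closed, and monotone if $\langle x-y,u-v\rangle\ge0$ for all $(x,u),(y,v)\in\operatorname{gph}A$. For $a,b\in\mathbb{R}^n$ let $\angle(a,b)=\arccos\left(\frac{\langle a,b\rangle}{\|a\|\|b\|}\right)$ if $a\ne0$ and $b\ne0$, and $\angle(a,b)=0$ otherwise (Euclidean inner product and norm). For $\theta\in[0,\pi]$, $A$ is $\theta$-angle-bounded if $\angle(x-y,u-v)\le\theta$ for all $(x,u),(y,v)\in\operatorname{gph}A$. *)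

theory Defs
  imports "HOL-Analysis.Analysis"
begin

type_synonym 'a set_op = "'a \<Rightarrow> 'a set"

definition gph :: "'a set_op \<Rightarrow> ('a \<times> 'a) set" where
  "gph A = {(x, u). u \<in> A x}"

definition outer_semicontinuous :: "'a::euclidean_space set_op \<Rightarrow> bool" where
  "outer_semicontinuous A \<longleftrightarrow> closed (gph A)"

definition monotone_op :: "'a::euclidean_space set_op \<Rightarrow> bool" where
  "monotone_op A \<longleftrightarrow> (\<forall>(x, u) \<in> gph A. \<forall>(y, v) \<in> gph A. (x - y) \<bullet> (u - v) \<ge> 0)"

definition angle :: "'a::euclidean_space \<Rightarrow> 'a \<Rightarrow> real" where
  "angle a b = (if a \<noteq> 0 \<and> b \<noteq> 0 then arccos ((a \<bullet> b) / (norm a * norm b)) else 0)"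

text \<open>The notion is only meant for angles in \<open>[0, \<pi>]\<close>; this range is part of the definition.\<close>

definition angle_bounded :: "real \<Rightarrow> 'a::euclidean_space set_op \<Rightarrow> bool" where
  "angle_bounded \<theta> A \<longleftrightarrow> \<theta> \<in> {0..pi} \<and>
     (\<forall>(x, u) \<in> gph A. \<forall>(y, v) \<in> gph A. angle (x - y) (u - v) \<le> \<theta>)"

definition ebers_moll_matrix :: "real \<Rightarrow> real \<Rightarrow> real^2^2" where
  "ebers_moll_matrix \<alpha>R \<alpha>F = vector [vector [1, - \<alpha>R], vector [- \<alpha>F, 1]]"

definition T_NPN :: "real \<Rightarrow> real \<Rightarrow> real set_op \<Rightarrow> (real^2) set_op" where
  "T_NPN \<alpha>R \<alpha>F TD v =
     {ebers_moll_matrix \<alpha>R \<alpha>F *v u | u. u $ 1 \<in> TD (v $ 1) \<and> u $ 2 \<in> TD (v $ 2)}"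

end

theory Submission
  imports Defs
begin

text \<open>
  Let \<open>(p, q)\<close> be the difference of two voltages, \<open>(a, b)\<close> the difference of the corresponding
  diode currents, and \<open>(c, d)\<close> its image under the Ebers--Moll matrix. Monotonicity of the diode
  gives \<open>p a \<ge> 0\<close> and \<open>q b \<ge> 0\<close>. Write \<open>m\<close> for the larger of the two gains. Since
  \<open>cos (\<pi>/2 + arctan m) = - m / sqrt (1 + m\<^sup>2)\<close>, the claim says that the cosine of the angle between
  \<open>(p, q)\<close> and \<open>(c, d)\<close> is at least this number.

  Both differences lie in a common closed quadrant. If it is one of the two mixed ones, then
  \<open>p b \<le> 0\<close> and \<open>q a \<le> 0\<close>, and since the gains enter the matrix with a negative sign, the cross
  terms only help: \<open>p c + q d \<ge> 0\<close>. Otherwise it is, up to a common sign, the nonnegative quadrant.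
  The matrix maps this quadrant into the cone \<open>c + m d \<ge> 0\<close>, \<open>d + m c \<ge> 0\<close>, because its gains are
  below \<open>1\<close>. This cone extends the quadrant by the angle \<open>arctan m\<close> on either side, and any two
  vectors of the quadrant are at most \<open>\<pi>/2\<close> apart, so the angles add up to at most
  \<open>\<pi>/2 + arctan m\<close>. The lemmas \<open>inner_ge_of_obtuse_cone\<close> and \<open>inner_ebers_moll_ge\<close> express this
  argument by inner products.
\<close>

lemma angle_le_pi_half_plus_arctan:
  assumes "0 \<le> m"
    and "- (m / sqrt (1 + m\<^sup>2)) * (norm x * norm y) \<le> x \<bullet> y"
  shows "angle x y \<le> pi / 2 + arctan m"
proof (cases "x = 0 \<or> y = 0")
  case True
  then show ?thesis
    using assms(1) by (auto simp: angle_def intro!: add_nonneg_nonneg)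
next
  case False
  define k where "k = (x \<bullet> y) / (norm x * norm y)"
  have pos: "norm x * norm y > 0"
    using False by simp
  have cos: "cos (pi / 2 + arctan m) = - (m / sqrt (1 + m\<^sup>2))"
    by (simp add: cos_add sin_arctan)
  have "cos (pi / 2 + arctan m) \<le> k"
    using assms(2) pos by (simp add: cos k_def pos_le_divide_eq)
  moreover have "k \<le> 1"
    using norm_cauchy_schwarz[of x y] pos by (simp add: k_def divide_le_eq_1)
  ultimately have "arccos k \<le> arccos (cos (pi / 2 + arctan m))"
    by (intro arccos_le_arccos) auto
  also have "\<dots> = pi / 2 + arctan m"
    using assms(1) arctan_ubound[of m] by (intro arccos_cos) (auto intro!: add_nonneg_nonneg)
  finally show ?thesis
    using False by (simp add: angle_def k_def)
qed

text \<open>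
  Only the negative coordinate \<open>d\<close> can pull the inner product below zero, by at most
  \<open>\<bar>d\<bar> sqrt (p\<^sup>2 + q\<^sup>2)\<close>; the slope bound \<open>\<bar>d\<bar> \<le> m c\<close> says that \<open>\<bar>d\<bar>\<close> is at most the sine of
  \<open>arctan m\<close> times the length of \<open>(c, d)\<close>.
\<close>

lemma inner_ge_of_slope:
  fixes p q c d m :: real
  assumes "0 \<le> p" "0 \<le> q" "0 \<le> m" "0 \<le> c" "d \<le> 0" "- d \<le> m * c"
  shows "- (m / sqrt (1 + m\<^sup>2)) * (sqrt (p\<^sup>2 + q\<^sup>2) * sqrt (c\<^sup>2 + d\<^sup>2)) \<le> p * c + q * d"
proof -
  have s: "sqrt (1 + m\<^sup>2) > 0"
    by (simp add: add_pos_nonneg)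
  have "(- d)\<^sup>2 \<le> (m * c)\<^sup>2"
    using assms by (intro power_mono) auto
  then have "(- d)\<^sup>2 * (1 + m\<^sup>2) \<le> m\<^sup>2 * (c\<^sup>2 + d\<^sup>2)"
    by (simp add: algebra_simps power_mult_distrib)
  then have "sqrt ((- d)\<^sup>2 * (1 + m\<^sup>2)) \<le> sqrt (m\<^sup>2 * (c\<^sup>2 + d\<^sup>2))"
    by (rule real_sqrt_le_mono)
  then have "- d * sqrt (1 + m\<^sup>2) \<le> m * sqrt (c\<^sup>2 + d\<^sup>2)"
    using assms by (simp add: real_sqrt_mult)
  then have d: "- d \<le> m / sqrt (1 + m\<^sup>2) * sqrt (c\<^sup>2 + d\<^sup>2)"
    using s by (simp add: field_simps)
  have q: "q \<le> sqrt (p\<^sup>2 + q\<^sup>2)"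
    by (rule real_le_rsqrt) simp
  have "q * (- d) \<le> sqrt (p\<^sup>2 + q\<^sup>2) * (m / sqrt (1 + m\<^sup>2) * sqrt (c\<^sup>2 + d\<^sup>2))"
    using q d assms by (intro mult_mono) auto
  moreover have "0 \<le> p * c"
    using assms by simp
  ultimately show ?thesis
    by (simp add: algebra_simps)
qed

lemma inner_ge_of_obtuse_cone:
  fixes p q c d m :: real
  assumes "0 \<le> p" "0 \<le> q" "0 \<le> m" "0 \<le> c + m * d" "0 \<le> d + m * c"
  shows "- (m / sqrt (1 + m\<^sup>2)) * (sqrt (p\<^sup>2 + q\<^sup>2) * sqrt (c\<^sup>2 + d\<^sup>2)) \<le> p * c + q * d"
proof -
  consider "0 \<le> c" "0 \<le> d" | "d < 0" | "c < 0"
    by linarith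
  then show ?thesis
  proof cases
    case 1
    have "- (m / sqrt (1 + m\<^sup>2)) * (sqrt (p\<^sup>2 + q\<^sup>2) * sqrt (c\<^sup>2 + d\<^sup>2)) \<le> 0"
      using assms(3) by (simp add: mult_nonneg_nonneg)
    also have "0 \<le> p * c + q * d"
      using assms 1 by simp
    finally show ?thesis .
  next
    case 2
    have "m * d \<le> 0"
      using 2 assms(3) by (simp add: mult_nonneg_nonpos)
    then have "0 \<le> c"
      using assms by linarith
    then show ?thesis
      using inner_ge_of_slope[of p q m c d] assms 2 by simp
  next
    case 3
    have "m * c \<le> 0"
      using 3 assms(3) by (simp add: mult_nonneg_nonpos)
    then have "0 \<le> d"
      using assms by linarith
    then show ?thesis
      using inner_ge_of_slope[of q p m d c] assms 3 by (simp add: add.commute)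
  qed
qed

text \<open>
  It suffices to check the two columns of the matrix, which span the image of the quadrant. On the
  first one the condition reads \<open>1 - m \<beta> \<ge> 0\<close>, and this is where gains of at most \<open>1\<close> matter; on
  the second it reads \<open>m - \<alpha> \<ge> 0\<close>, which is why \<open>m\<close> has to dominate both gains.
\<close>

lemma ebers_moll_obtuse_cone:
  fixes a b \<alpha> \<beta> m :: real
  assumes "0 \<le> a" "0 \<le> b" "0 \<le> \<beta>" "\<alpha> \<le> m" "\<beta> \<le> m" "m \<le> 1"
  shows "0 \<le> (a - \<alpha> * b) + m * (b - \<beta> * a)"
proof -
  have "m * \<beta> \<le> 1 * 1"
    using assms by (intro mult_mono) auto
  then have "0 \<le> a * (1 - m * \<beta>)"
    using assms by simp
  moreover have "0 \<le> b * (m - \<alpha>)"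
    using assms by simp
  ultimately show ?thesis
    by (simp add: algebra_simps)
qed

lemma inner_ebers_moll_ge:
  fixes p q a b \<alpha> \<beta> m :: real
  assumes "0 \<le> p * a" "0 \<le> q * b" "0 \<le> \<alpha>" "0 \<le> \<beta>" "\<alpha> \<le> m" "\<beta> \<le> m" "m \<le> 1"
  defines "c \<equiv> a - \<alpha> * b" and "d \<equiv> b - \<beta> * a"
  shows "- (m / sqrt (1 + m\<^sup>2)) * (sqrt (p\<^sup>2 + q\<^sup>2) * sqrt (c\<^sup>2 + d\<^sup>2)) \<le> p * c + q * d"
proof -
  have m: "0 \<le> m"
    using assms by linarith
  have quadrant: "- (m / sqrt (1 + m\<^sup>2)) *
        (sqrt (p'\<^sup>2 + q'\<^sup>2) * sqrt ((a' - \<alpha> * b')\<^sup>2 + (b' - \<beta> * a')\<^sup>2))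
      \<le> p' * (a' - \<alpha> * b') + q' * (b' - \<beta> * a')"
    if "0 \<le> p'" "0 \<le> q'" "0 \<le> a'" "0 \<le> b'" for p' q' a' b'
    using that assms(3-7) m ebers_moll_obtuse_cone[of a' b' \<beta> \<alpha> m]
      ebers_moll_obtuse_cone[of b' a' \<alpha> \<beta> m]
    by (intro inner_ge_of_obtuse_cone) auto
  consider "p * b \<le> 0" "q * a \<le> 0"
    | "0 \<le> p" "0 \<le> q" "0 \<le> a" "0 \<le> b" | "p \<le> 0" "q \<le> 0" "a \<le> 0" "b \<le> 0"
    using assms(1,2) by (smt (verit) mult_nonneg_nonpos mult_nonpos_nonneg zero_le_mult_iff)
  then show ?thesis
  proof cases
    case 1
    have "- (m / sqrt (1 + m\<^sup>2)) * (sqrt (p\<^sup>2 + q\<^sup>2) * sqrt (c\<^sup>2 + d\<^sup>2)) \<le> 0"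
      using m by (simp add: mult_nonneg_nonneg)
    also have "0 \<le> p * c + q * d"
    proof -
      have "\<alpha> * (p * b) \<le> 0" "\<beta> * (q * a) \<le> 0"
        using 1 assms(3,4) by (simp_all add: mult_nonneg_nonpos)
      then show ?thesis
        using assms(1,2) by (simp add: c_def d_def algebra_simps)
    qed
    finally show ?thesis .
  next
    case 2
    then show ?thesis
      unfolding c_def d_def by (rule quadrant)
  next
    case 3
    have neg: "(- a - \<alpha> * - b) = - c" "(- b - \<beta> * - a) = - d"
      by (simp_all add: c_def d_def)
    show ?thesis
      using quadrant[of "- p" "- q" "- a" "- b"] 3 unfolding neg by simp
  qed
qed

theorem proposition8:
  fixes \<alpha>R \<alpha>F :: real and TD :: "real \<Rightarrow> real set"
  assumes "\<alpha>R \<in> {0..<1}" and "\<alpha>F \<in> {0..<1}"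
    and "monotone_op TD" and "outer_semicontinuous TD"
  shows "angle_bounded (pi / 2 + max (arctan \<alpha>F) (arctan \<alpha>R)) (T_NPN \<alpha>R \<alpha>F TD)"
proof -
  define m where "m = max \<alpha>F \<alpha>R"
  have m: "0 \<le> m" "\<alpha>R \<le> m" "\<alpha>F \<le> m" "m \<le> 1"
    using assms(1,2) by (auto simp: m_def)
  have arctan_m: "max (arctan \<alpha>F) (arctan \<alpha>R) = arctan m"
    by (simp add: m_def max_def arctan_le_iff)
  have "angle (x - y) (ebers_moll_matrix \<alpha>R \<alpha>F *v u - ebers_moll_matrix \<alpha>R \<alpha>F *v v)
      \<le> pi / 2 + arctan m"
    if "u $ 1 \<in> TD (x $ 1)" "u $ 2 \<in> TD (x $ 2)" "v $ 1 \<in> TD (y $ 1)" "v $ 2 \<in> TD (y $ 2)"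
    for x y u v
  proof -
    have diode: "0 \<le> (x $ i - y $ i) * (u $ i - v $ i)"
      if "u $ i \<in> TD (x $ i)" "v $ i \<in> TD (y $ i)" for i
      using assms(3) that by (force simp: monotone_op_def gph_def)
    define w where "w = u - v"
    define z where "z = ebers_moll_matrix \<alpha>R \<alpha>F *v w"
    have z: "z $ 1 = w $ 1 - \<alpha>R * w $ 2" "z $ 2 = w $ 2 - \<alpha>F * w $ 1"
      by (simp_all add: z_def ebers_moll_matrix_def matrix_vector_mult_def sum_2)
    have norm: "norm t = sqrt ((t $ 1)\<^sup>2 + (t $ 2)\<^sup>2)" for t :: "real^2"
      by (simp add: norm_vec_def L2_set_def sum_2)
    have "- (m / sqrt (1 + m\<^sup>2)) * (norm (x - y) * norm z) \<le> (x - y) \<bullet> z"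
      using inner_ebers_moll_ge[of "(x - y) $ 1" "w $ 1" "(x - y) $ 2" "w $ 2" \<alpha>R \<alpha>F m]
        diode[of 1] diode[of 2] that assms(1,2) m
      by (simp add: norm inner_vec_def sum_2 z w_def)
    then have "angle (x - y) z \<le> pi / 2 + arctan m"
      using m by (intro angle_le_pi_half_plus_arctan)
    then show ?thesis
      by (simp add: z_def w_def matrix_vector_mult_diff_distrib)
  qed
  moreover have "pi / 2 + arctan m \<in> {0..pi}"
    using m arctan_ubound[of m] by (auto intro!: add_nonneg_nonneg)
  ultimately show ?thesis
    unfolding angle_bounded_def arctan_m by (auto simp: gph_def T_NPN_def)
qed

end
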